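(* Let $A$ be an integral domain with field of fractions $Q(A)$, let $p\in Q(A)$ be a plant and let $0\neq\Theta\in Q(A)$ be a signal generator. The robust regulation problem for $p$ with signal generator $\Theta$ is solvable if and only if there exists a stabilizing controller $c=\frac{b}{a}$ of $p$, with $0\neq a\in A$ and $b\in A$ satisfying $a-p\,b=1$ and $p\,a\in A$, and there exist $\alpha,\beta\in A$ such that $$\alpha\,\Theta^{-1}-\beta\, b\, p=1.$$
   Context: An integral domain is a commutative ring with unit $1$ and without zero divisors. A controller $c\in Q(A)$ stabilizes $p\in Q(A)$ if $1-pc\neq 0$ and $\frac{1}{1-pc},\ \frac{p}{1-pc},\ \frac{c}{1-pc}$ all belong to $A$. $\mathrm{Stab}(p)$ denotes the set of all stabilizing controllers of $p$. A controller $c$ is robustly regulating (for $p$, with signal generator $\Theta$) if $c\in\mathrm{Stab}(p)$ and for every $p'\in\mathrm{Stab}(c)$ one has $\Theta\,\frac{1}{1-p'c}\in A$ and $\Theta\,\frac{p'}{1-p'c}\in A$. The robust regulation problem is the problem of finding a robustly regulating controller; it is solvable if such a controller exists. *)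

theory Defs
  imports "HOL-Computational_Algebra.Polynomial_Factorial"
begin

text \<open>The integral domain $A$ is the type \<open>'a :: idom\<close>, its field of fractions $Q(A)$ is
  \<open>'a fract\<close>, and $A$ is regarded as a subring of $Q(A)$ via \<^const>\<open>to_fract\<close>.\<close>

abbreviation ring_elems :: "'a :: idom fract set"
  where "ring_elems \<equiv> range to_fract"

text \<open>The plant may be any fraction: robust regulation below uses \<open>Stab c\<close> with the
  controller \<open>c\<close> in its place.\<close>

definition stabilizes :: "'a :: idom fract \<Rightarrow> 'a fract \<Rightarrow> bool"
  where "stabilizes c p \<longleftrightarrow>
    1 - p * c \<noteq> 0 \<and>
    1 / (1 - p * c) \<in> ring_elems \<and>
    p / (1 - p * c) \<in> ring_elems \<and>
    c / (1 - p * c) \<in> ring_elems"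

definition Stab :: "'a :: idom fract \<Rightarrow> 'a fract set"
  where "Stab p = {c. stabilizes c p}"

definition robustly_regulating :: "'a :: idom fract \<Rightarrow> 'a fract \<Rightarrow> 'a fract \<Rightarrow> bool"
  where "robustly_regulating \<Theta> p c \<longleftrightarrow>
    c \<in> Stab p \<and>
    (\<forall>p' \<in> Stab c.
      \<Theta> * (1 / (1 - p' * c)) \<in> ring_elems \<and>
      \<Theta> * (p' / (1 - p' * c)) \<in> ring_elems)"

definition robust_regulation_solvable :: "'a :: idom fract \<Rightarrow> 'a fract \<Rightarrow> bool"
  where "robust_regulation_solvable \<Theta> p \<longleftrightarrow> (\<exists>c. robustly_regulating \<Theta> p c)"

end

theory Submission
  imports Defs
begin

text \<open>For a stabilizing controller \<open>c\<close> of \<open>p\<close> put \<open>a = 1 / (1 - p c)\<close>, \<open>b = c a\<close> and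
  \<open>n = p a\<close>. These lie in \<open>A\<close>, and \<open>a - p b = a - c n = 1\<close>.

  The quantifier over all \<open>p' \<in> Stab c\<close> collapses to the nominal plant
  (\<open>robustly_regulating_iff\<close>): multiplying \<open>a - c n = 1\<close> by either closed-loop transfer function
  of \<open>p'\<close> writes it as a combination of \<open>a\<close> and \<open>n\<close> with coefficients in \<open>A\<close>.
  Hence \<open>c\<close> is robustly regulating iff \<open>\<Theta> a\<close> and \<open>\<Theta> n\<close> lie in \<open>A\<close>.

  If this holds, then \<open>\<alpha> = \<Theta> a\<close> and \<open>\<beta> = 1\<close> solve \<open>\<alpha> \<Theta>\<inverse> - \<beta> b p = 1\<close>. Conversely, a solution
  gives the element \<open>x = \<alpha> \<Theta>\<inverse> = 1 + \<beta> b p\<close> of \<open>A\<close>, and the controller with \<open>a' = a x\<close> and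
  \<open>b' = b (1 + \<beta> a)\<close> stabilizes \<open>p\<close>, while \<open>\<Theta> a' = \<alpha> a\<close> and \<open>\<Theta> p a' = \<alpha> n\<close>. This requires
  \<open>a' \<noteq> 0\<close>, that is \<open>\<alpha> \<noteq> 0\<close>. A solution with \<open>\<alpha> = 0\<close> makes \<open>b p\<close> a unit of \<open>A\<close>, so that any
  denominator of \<open>\<Theta>\<close> may serve as \<open>x\<close> instead (\<open>nonzero_bezout_solution\<close>).\<close>

lemma ring_elems_one: "1 \<in> ring_elems"
  by (metis rangeI to_fract_1)

lemma ring_elems_add: "x \<in> ring_elems \<Longrightarrow> y \<in> ring_elems \<Longrightarrow> x + y \<in> ring_elems"
  by (elim rangeE) (simp only: to_fract_add[symmetric] rangeI)

lemma ring_elems_diff: "x \<in> ring_elems \<Longrightarrow> y \<in> ring_elems \<Longrightarrow> x - y \<in> ring_elems"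
  by (elim rangeE) (simp only: to_fract_diff[symmetric] rangeI)

lemma ring_elems_mult: "x \<in> ring_elems \<Longrightarrow> y \<in> ring_elems \<Longrightarrow> x * y \<in> ring_elems"
  by (elim rangeE) (simp only: to_fract_mult[symmetric] rangeI)

lemmas ring_elems_closed = ring_elems_one ring_elems_add ring_elems_diff ring_elems_mult

lemma fract_cases_to_fract:
  fixes x :: "'a :: idom fract"
  obtains u v :: 'a where "v \<noteq> 0" "x = to_fract u / to_fract v"
  by (metis Fract_conv_to_fract Fract_cases)

lemma closed_loop_eq:
  fixes p a b :: "'a :: field"
  assumes "a \<noteq> 0" "a - p * b = 1"
  shows "1 - p * (b / a) = 1 / a"
  using assms by (simp add: field_simps)

lemma stabilizesI:
  fixes p a b :: "'a :: idom fract"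
  assumes "a \<noteq> 0" "a - p * b = 1" "a \<in> ring_elems" "b \<in> ring_elems" "p * a \<in> ring_elems"
  shows "stabilizes (b / a) p"
  unfolding stabilizes_def closed_loop_eq[OF assms(1,2)] using assms by simp

lemma robustly_regulating_iff:
  fixes p c \<Theta> :: "'a :: idom fract"
  assumes "stabilizes c p"
  shows "robustly_regulating \<Theta> p c \<longleftrightarrow>
    \<Theta> * (1 / (1 - p * c)) \<in> ring_elems \<and> \<Theta> * (p / (1 - p * c)) \<in> ring_elems"
    (is "_ \<longleftrightarrow> ?nominal")
proof
  assume "robustly_regulating \<Theta> p c"
  moreover have "p \<in> Stab c"
    using assms by (simp add: Stab_def stabilizes_def mult.commute)
  ultimately show ?nominal
    unfolding robustly_regulating_def by blast
next
  assume nominal: ?nominal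
  define a n where "a = 1 / (1 - p * c)" and "n = p / (1 - p * c)"
  have \<Theta>a: "\<Theta> * a \<in> ring_elems" and \<Theta>n: "\<Theta> * n \<in> ring_elems"
    using nominal by (simp_all add: a_def n_def)
  have "1 - p * c \<noteq> 0"
    using assms by (simp add: stabilizes_def)
  then have bez: "a - c * n = 1"
    by (simp add: a_def n_def field_simps)
  have "\<Theta> * (1 / (1 - p' * c)) \<in> ring_elems \<and> \<Theta> * (p' / (1 - p' * c)) \<in> ring_elems"
    if "p' \<in> Stab c" for p'
  proof -
    define a' where "a' = 1 / (1 - p' * c)"
    have "1 - p' * c \<noteq> 0" and a': "a' \<in> ring_elems" and ca': "c * a' \<in> ring_elems"
      and pa': "p' * a' \<in> ring_elems"
      using that by (simp_all add: Stab_def stabilizes_def a'_def mult.commute[of c p'])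
    then have a'_eq: "c * (p' * a') = a' - 1"
      by (simp add: a'_def field_simps)
    have "\<Theta> * a' = \<Theta> * a' * (a - c * n)"
      by (simp add: bez)
    also have "\<dots> = \<Theta> * a * a' - \<Theta> * n * (c * a')"
      by (simp add: algebra_simps)
    finally have 1: "\<Theta> * a' \<in> ring_elems"
      using \<Theta>a \<Theta>n a' ca' by (simp add: ring_elems_closed)
    have "\<Theta> * (p' * a') = \<Theta> * (p' * a') * (a - c * n)"
      by (simp add: bez)
    also have "\<dots> = \<Theta> * a * (p' * a') - \<Theta> * n * (c * (p' * a'))"
      by (simp add: algebra_simps)
    finally have 2: "\<Theta> * (p' * a') \<in> ring_elems"
      using \<Theta>a \<Theta>n a' pa' unfolding a'_eq by (simp add: ring_elems_closed)
    show ?thesis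
      using 1 2 by (simp add: a'_def)
  qed
  then show "robustly_regulating \<Theta> p c"
    using assms unfolding robustly_regulating_def Stab_def by blast
qed

text \<open>In the application \<open>y = b p\<close>. When the given solution has \<open>\<alpha> = 0\<close>, so that \<open>- \<beta>\<close> is an
  inverse of \<open>y\<close>, write \<open>\<Theta> = u / v\<close>; then \<open>\<alpha>' = u\<close> and \<open>\<beta>' = \<beta> (1 - v)\<close> is another solution.\<close>
lemma nonzero_bezout_solution:
  fixes \<Theta> y :: "'a :: idom fract" and \<alpha> \<beta> :: 'a
  assumes "\<Theta> \<noteq> 0" "to_fract \<alpha> * inverse \<Theta> - to_fract \<beta> * y = 1"
  obtains \<alpha>' \<beta>' :: 'a
  where "\<alpha>' \<noteq> 0" "to_fract \<alpha>' * inverse \<Theta> - to_fract \<beta>' * y = 1"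
proof (cases "\<alpha> = 0")
  case False
  then show ?thesis using assms(2) that by blast
next
  case True
  obtain u v :: 'a where v: "v \<noteq> 0" and \<Theta>: "\<Theta> = to_fract u / to_fract v"
    by (rule fract_cases_to_fract)
  have u: "u \<noteq> 0"
    using assms(1) \<Theta> by auto
  have y: "to_fract \<beta> * y = - 1"
    using assms(2) True by (metis diff_0 minus_minus mult_zero_left to_fract_0)
  have "to_fract u * inverse \<Theta> = to_fract v"
    using u v by (simp add: \<Theta>)
  moreover have "to_fract (\<beta> * (1 - v)) * y = (1 - to_fract v) * (to_fract \<beta> * y)"
    by (simp add: algebra_simps)
  ultimately have "to_fract u * inverse \<Theta> - to_fract (\<beta> * (1 - v)) * y = 1"
    by (simp add: y)
  then show ?thesis using u that by blast
qed

theorem theorem4p3: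
  fixes p \<Theta> :: "'a :: idom fract"
  assumes "\<Theta> \<noteq> 0"
  shows "robust_regulation_solvable \<Theta> p \<longleftrightarrow>
    (\<exists>c \<in> Stab p. \<exists>a b :: 'a.
      a \<noteq> 0 \<and> c = to_fract b / to_fract a \<and>
      to_fract a - p * to_fract b = 1 \<and>
      p * to_fract a \<in> ring_elems \<and>
      (\<exists>\<alpha> \<beta> :: 'a. to_fract \<alpha> * inverse \<Theta> - to_fract \<beta> * to_fract b * p = 1))"
    (is "_ \<longleftrightarrow> ?rhs")
proof
  assume "robust_regulation_solvable \<Theta> p"
  then obtain c where rr: "robustly_regulating \<Theta> p c"
    unfolding robust_regulation_solvable_def by blast
  then have cS: "c \<in> Stab p" and st: "stabilizes c p"
    by (simp_all add: robustly_regulating_def Stab_def)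
  from st have nz: "1 - p * c \<noteq> 0"
    by (simp add: stabilizes_def)
  from st obtain a b :: 'a where a: "1 / (1 - p * c) = to_fract a"
    and b: "c / (1 - p * c) = to_fract b" and pa: "p / (1 - p * c) \<in> ring_elems"
    unfolding stabilizes_def by blast
  obtain \<alpha> :: 'a where \<alpha>: "\<Theta> * to_fract a = to_fract \<alpha>"
    using rr robustly_regulating_iff[OF st] a by auto
  have bez: "to_fract a - p * to_fract b = 1"
    using nz by (simp add: a[symmetric] b[symmetric] field_simps)
  have "a \<noteq> 0"
    using a nz by auto
  moreover have "c = to_fract b / to_fract a"
    using nz by (simp add: a[symmetric] b[symmetric])
  moreover have "p * to_fract a \<in> ring_elems"
    using pa by (simp add: a[symmetric])
  moreover have "to_fract \<alpha> * inverse \<Theta> - to_fract 1 * to_fract b * p = 1"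
  proof -
    have "to_fract \<alpha> * inverse \<Theta> = to_fract a"
      using assms by (simp flip: \<alpha>)
    then show ?thesis
      using bez by (simp add: mult.commute)
  qed
  ultimately show ?rhs
    using cS bez by blast
next
  assume ?rhs
  then obtain a b \<alpha>0 \<beta>0 :: 'a where a: "a \<noteq> 0"
    and ab: "to_fract a - p * to_fract b = 1"
    and pa: "p * to_fract a \<in> ring_elems"
    and "to_fract \<alpha>0 * inverse \<Theta> - to_fract \<beta>0 * (to_fract b * p) = 1"
    by (auto simp: mult.assoc)
  then obtain \<alpha> \<beta> :: 'a where \<alpha>: "\<alpha> \<noteq> 0"
    and bez: "to_fract \<alpha> * inverse \<Theta> - to_fract \<beta> * (to_fract b * p) = 1"
    using nonzero_bezout_solution[OF assms] by blast
  have bp: "to_fract b * p = to_fract a - 1"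
    using ab by (simp add: algebra_simps)
  define x where "x = to_fract \<alpha> * inverse \<Theta>"
  have x: "x = 1 + to_fract \<beta> * (to_fract a - 1)"
    using bez unfolding x_def bp by (simp add: diff_eq_eq)
  have \<Theta>x: "\<Theta> * x = to_fract \<alpha>" and x0: "x \<noteq> 0"
    using assms \<alpha> by (simp_all add: x_def)
  have xA: "x \<in> ring_elems"
    unfolding x by (simp add: ring_elems_closed)
  define a' b' where "a' = to_fract a * x" and "b' = to_fract b * (1 + to_fract \<beta> * to_fract a)"
  have a'0: "a' \<noteq> 0"
    using a x0 by (simp add: a'_def)
  have "p * b' = (to_fract b * p) * (1 + to_fract \<beta> * to_fract a)"
    by (simp add: b'_def)
  then have ab': "a' - p * b' = 1"
    unfolding bp by (simp add: a'_def x algebra_simps)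
  have pa': "p * a' = p * to_fract a * x"
    by (simp add: a'_def)
  have st: "stabilizes (b' / a') p"
  proof (rule stabilizesI[OF a'0 ab'])
    show "a' \<in> ring_elems" "b' \<in> ring_elems" "p * a' \<in> ring_elems"
      unfolding pa' using xA pa by (simp_all add: a'_def b'_def ring_elems_closed)
  qed
  have "\<Theta> * a' = to_fract a * to_fract \<alpha>"
    by (simp add: a'_def \<Theta>x[symmetric])
  moreover have "\<Theta> * (p * a') = p * to_fract a * to_fract \<alpha>"
    by (simp add: a'_def \<Theta>x[symmetric])
  ultimately have "\<Theta> * a' \<in> ring_elems" "\<Theta> * (p * a') \<in> ring_elems"
    using pa by (simp_all only: ring_elems_mult rangeI)
  then have "robustly_regulating \<Theta> p (b' / a')"
    unfolding robustly_regulating_iff[OF st] closed_loop_eq[OF a'0 ab'] by simp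
  then show "robust_regulation_solvable \<Theta> p"
    unfolding robust_regulation_solvable_def by blast
qed

end
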